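(* Let $V=V^{(1)}\otimes\cdots\otimes V^{(d)}$ be a tensor product of finite dimensional complex Hilbert spaces. Suppose that $T\in V$ has a diagonal singular value decomposition with singular values $\sigma_1\geq\sigma_2\geq\cdots\geq\sigma_r>0$. Then $$\|T\|_\star=\sum_{i=1}^r\sigma_i,\qquad [T]=\sigma_1,\qquad \|T\|=\sqrt{\sum_{i=1}^r\sigma_i^2}.$$
   Context: $V$ carries the Hilbert space structure with $\langle v^{(1)}\otimes\cdots\otimes v^{(d)},w^{(1)}\otimes\cdots\otimes w^{(d)}\rangle=\prod_e\langle v^{(e)},w^{(e)}\rangle$, and $\|\cdot\|$ is its Hilbert space norm. A pure tensor in $V$ is an element of the form $v^{(1)}\otimes\cdots\otimes v^{(d)}$ with $v^{(e)}\in V^{(e)}$. The nuclear norm $\|T\|_\star$ is the smallest possible value of $\sum_{i=1}^m\|v_i\|$ over all decompositions $T=\sum_{i=1}^m v_i$ ($m$ arbitrary) into pure tensors. The spectral norm $[T]$ is the maximum of $|\langle T,u\rangle|$ over all pure tensors $u\in V$ of unit length. For an $r$-tuple $\mathbf{S}=(S_1,\dots,S_r)$ of tensors in $V$ and $\alpha>0$, $[\mathbf{S}]_\alpha$ is the maximum of $\big(\sum_{i=1}^r|\langle S_i,u\rangle|^\alpha\big)^{1/\alpha}$ over all pure tensors $u\in V$ of unit length. For real $t\geq 1$, an $r$-tuple $\mathbf{S}$ of tensors of unit length is called $t$-orthogonal if $[\mathbf{S}]_{2/t}=1$. A diagonal singular value decomposition of $T$ is a decomposition $T=\sum_{i=1}^r\sigma_iv_i$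 where $\sigma_1\geq\sigma_2\geq\cdots\geq\sigma_r>0$ are real and $(v_1,\dots,v_r)$ is a $2$-orthogonal $r$-tuple of pure tensors of unit length; $\sigma_1,\dots,\sigma_r$ are called its singular values. *)

theory Defs
  imports "HOL-Analysis.Analysis"
begin

text \<open>
  Complex inner product spaces. The underlying real vector space carries the real part of the
  complex inner product, so \<open>norm\<close> is the Hilbert space norm; positive definiteness and
  \<open>1 *\<^sub>C x = x\<close> are inherited from \<open>real_inner\<close>.
\<close>

class complex_inner = real_inner +
  fixes scaleC :: "complex \<Rightarrow> 'a \<Rightarrow> 'a"  (infixr "*\<^sub>C" 75)
    and cinner :: "'a \<Rightarrow> 'a \<Rightarrow> complex"
  assumes scaleC_add_right: "a *\<^sub>C (x + y) = a *\<^sub>C x + a *\<^sub>C y"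
    and scaleC_add_left: "(a + b) *\<^sub>C x = a *\<^sub>C x + b *\<^sub>C x"
    and scaleC_scaleC: "a *\<^sub>C b *\<^sub>C x = (a * b) *\<^sub>C x"
    and scaleR_scaleC: "c *\<^sub>R x = complex_of_real c *\<^sub>C x"
    and cinner_add_left: "cinner (x + y) z = cinner x z + cinner y z"
    and cinner_scaleC_left: "cinner (a *\<^sub>C x) y = a * cinner x y"
    and cinner_commute: "cinner x y = cnj (cinner y x)"
    and inner_eq_Re_cinner: "inner x y = Re (cinner x y)"

global_interpretation complex_vector:
  vector_space "scaleC :: complex \<Rightarrow> 'a \<Rightarrow> 'a::complex_inner"
proof
  fix x :: 'a
  show "1 *\<^sub>C x = x"
    using scaleR_scaleC[of 1 x] by simp
qed (simp_all add: scaleC_add_right scaleC_add_left scaleC_scaleC)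

definition pure_tensors :: "nat \<Rightarrow> (nat \<Rightarrow> 'a set) \<Rightarrow> ((nat \<Rightarrow> 'a) \<Rightarrow> 'b) \<Rightarrow> 'b set" where
  "pure_tensors d V tensor = tensor ` (\<Pi>\<^sub>E e\<in>{1..d}. V e)"

text \<open>
  \<open>W\<close> is the Hilbert space tensor product of \<open>V 1, \<dots>, V d\<close>, where \<open>tensor v\<close> stands for
  \<open>v 1 \<otimes> \<dots> \<otimes> v d\<close>. The factors are finite dimensional subspaces of one inner product space
  \<open>'a\<close>, which is no restriction: pass to their orthogonal direct sum. The tensor product is not
  tied to a construction: a multilinear map whose values span \<open>W\<close> and satisfy the product formula
  for inner products determines \<open>W\<close> up to unique isometric isomorphism, and in particular has the
  universal property of the tensor product.
\<close>

locale hilbert_tensor_product =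
  fixes d :: nat
    and V :: "nat \<Rightarrow> 'a::complex_inner set"
    and W :: "'b::complex_inner set"
    and tensor :: "(nat \<Rightarrow> 'a) \<Rightarrow> 'b"
  assumes d_pos: "1 \<le> d"
    and finite_dim: "e \<in> {1..d} \<Longrightarrow> \<exists>B. finite B \<and> V e = complex_vector.span B"
    and tensor_add: "\<lbrakk>v \<in> (\<Pi>\<^sub>E e\<in>{1..d}. V e); e \<in> {1..d}; x \<in> V e; y \<in> V e\<rbrakk>
      \<Longrightarrow> tensor (v(e := x + y)) = tensor (v(e := x)) + tensor (v(e := y))"
    and tensor_scaleC: "\<lbrakk>v \<in> (\<Pi>\<^sub>E e\<in>{1..d}. V e); e \<in> {1..d}; x \<in> V e\<rbrakk>
      \<Longrightarrow> tensor (v(e := a *\<^sub>C x)) = a *\<^sub>C tensor (v(e := x))"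
    and cinner_tensor: "\<lbrakk>v \<in> (\<Pi>\<^sub>E e\<in>{1..d}. V e); w \<in> (\<Pi>\<^sub>E e\<in>{1..d}. V e)\<rbrakk>
      \<Longrightarrow> cinner (tensor v) (tensor w) = (\<Prod>e=1..d. cinner (v e) (w e))"
    and span_tensor: "W = complex_vector.span (pure_tensors d V tensor)"

text \<open>
  Below, \<open>P\<close> is the set of pure tensors, and an \<open>r\<close>-tuple is a function on \<open>nat\<close> of which only
  the values on \<open>{1..r}\<close> matter. The minimum and the maxima are attained, by compactness of the
  set of unit pure tensors; the maxima require all factors to be nonzero, since otherwise there
  are no unit pure tensors.
\<close>

definition nuclear_norm :: "'b::complex_inner set \<Rightarrow> 'b \<Rightarrow> real" where
  "nuclear_norm P T = (LEAST s. \<exists>(m::nat) v. (\<forall>i\<in>{1..m}. v i \<in> P) \<and>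
     T = (\<Sum>i=1..m. v i) \<and> s = (\<Sum>i=1..m. norm (v i)))"

definition spectral_norm :: "'b::complex_inner set \<Rightarrow> 'b \<Rightarrow> real" where
  "spectral_norm P T = (GREATEST s. \<exists>u\<in>P. norm u = 1 \<and> s = cmod (cinner T u))"

definition tuple_norm :: "'b::complex_inner set \<Rightarrow> real \<Rightarrow> nat \<Rightarrow> (nat \<Rightarrow> 'b) \<Rightarrow> real" where
  "tuple_norm P \<alpha> r S = (GREATEST s. \<exists>u\<in>P. norm u = 1 \<and>
     s = (\<Sum>i=1..r. cmod (cinner (S i) u) powr \<alpha>) powr (1 / \<alpha>))"

text \<open>Meant for \<open>t \<ge> 1\<close>.\<close>

definition t_orthogonal :: "'b::complex_inner set \<Rightarrow> real \<Rightarrow> nat \<Rightarrow> (nat \<Rightarrow> 'b) \<Rightarrow> bool" where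
  "t_orthogonal P t r S \<longleftrightarrow>
     (\<forall>i\<in>{1..r}. norm (S i) = 1) \<and> tuple_norm P (2 / t) r S = 1"

definition diagonal_svd ::
    "'b::complex_inner set \<Rightarrow> 'b \<Rightarrow> nat \<Rightarrow> (nat \<Rightarrow> real) \<Rightarrow> (nat \<Rightarrow> 'b) \<Rightarrow> bool" where
  "diagonal_svd P T r \<sigma> v \<longleftrightarrow>
     1 \<le> r \<and> antimono_on {1..r} \<sigma> \<and> \<sigma> r > 0 \<and>
     (\<forall>i\<in>{1..r}. v i \<in> P) \<and> t_orthogonal P 2 r v \<and>
     T = (\<Sum>i=1..r. \<sigma> i *\<^sub>R v i)"

end

theory Submission
  imports Defs
begin

text \<open>
  The unit spheres of the factors are compact, so the maximum defining \<open>[\<bold>v]\<^sub>1\<close> is attained and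
  2-orthogonality says that \<open>\<Sum>\<^sub>i |\<langle>v\<^sub>i, u\<rangle>| \<le> 1\<close> for all unit pure tensors \<open>u\<close>. Taking \<open>u = v\<^sub>j\<close> shows
  that the \<open>v\<^sub>i\<close> are orthonormal, which gives the Hilbert space norm; the spectral norm follows from
  \<open>|\<langle>T, u\<rangle>| \<le> \<sigma>\<^sub>1 \<Sum>\<^sub>i |\<langle>v\<^sub>i, u\<rangle>|\<close>. For the nuclear norm, the spectral norm of \<open>\<Sum>\<^sub>i v\<^sub>i\<close> is at most 1,
  so pairing any decomposition of \<open>T\<close> into pure tensors with \<open>\<Sum>\<^sub>i v\<^sub>i\<close> bounds its cost below by
  \<open>\<langle>T, \<Sum>\<^sub>i v\<^sub>i\<rangle> = \<Sum>\<^sub>i \<sigma>\<^sub>i\<close>.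
\<close>

section \<open>Algebra and continuity of the complex inner product\<close>

lemma cinner_add_right: "cinner x (y + z) = cinner x y + cinner x (z :: 'a::complex_inner)"
  by (metis cinner_add_left cinner_commute complex_cnj_add)

lemma cinner_scaleC_right: "cinner x (a *\<^sub>C y) = cnj a * cinner x (y :: 'a::complex_inner)"
  by (metis cinner_scaleC_left cinner_commute complex_cnj_mult)

lemma cinner_scaleR_left: "cinner (c *\<^sub>R x) y = of_real c * cinner x (y :: 'a::complex_inner)"
  by (simp add: scaleR_scaleC cinner_scaleC_left)

lemma cinner_scaleR_right: "cinner x (c *\<^sub>R y) = of_real c * cinner x (y :: 'a::complex_inner)"
  by (simp add: scaleR_scaleC cinner_scaleC_right)

lemma cinner_zero_left [simp]: "cinner 0 y = 0" for y :: "'a::complex_inner"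
  using cinner_add_left[of 0 0 y] by simp

lemma cinner_zero_right [simp]: "cinner x 0 = 0" for x :: "'a::complex_inner"
  using cinner_add_right[of x 0 0] by simp

lemma cinner_diff_left: "cinner (x - y) z = cinner x z - cinner y (z :: 'a::complex_inner)"
  using cinner_add_left[of "x - y" y z] by simp

lemma cinner_sum_left: "cinner (\<Sum>i\<in>A. f i) y = (\<Sum>i\<in>A. cinner (f i) (y :: 'a::complex_inner))"
  by (induction A rule: infinite_finite_induct) (auto simp: cinner_add_left)

lemma cinner_sum_right: "cinner x (\<Sum>i\<in>A. f i) = (\<Sum>i\<in>A. cinner (x :: 'a::complex_inner) (f i))"
  by (induction A rule: infinite_finite_induct) (auto simp: cinner_add_right)

lemma cinner_self: "cinner x x = of_real ((norm x)\<^sup>2)" for x :: "'a::complex_inner"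
proof (rule complex_eqI)
  show "Re (cinner x x) = Re (of_real ((norm x)\<^sup>2))"
    by (simp add: inner_eq_Re_cinner[symmetric] power2_norm_eq_inner)
  have "cinner x x = cnj (cinner x x)" by (rule cinner_commute)
  then have "Im (cinner x x) = - Im (cinner x x)" by (metis cnj.sel(2))
  then show "Im (cinner x x) = Im (of_real ((norm x)\<^sup>2))" by simp
qed

lemma norm_scaleC: "norm (a *\<^sub>C x) = cmod a * norm x" for x :: "'a::complex_inner"
proof -
  have "complex_of_real ((norm (a *\<^sub>C x))\<^sup>2) = a * cnj a * of_real ((norm x)\<^sup>2)"
    unfolding cinner_self[symmetric] by (simp add: cinner_scaleC_left cinner_scaleC_right)
  also have "\<dots> = of_real ((cmod a * norm x)\<^sup>2)"
    by (simp add: complex_norm_square[symmetric] power_mult_distrib)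
  finally have "(norm (a *\<^sub>C x))\<^sup>2 = (cmod a * norm x)\<^sup>2" using of_real_eq_iff by blast
  then show ?thesis by (simp add: power2_eq_iff_nonneg)
qed

lemma continuous_on_scaleC_left:
  assumes "continuous_on S f"
  shows "continuous_on S (\<lambda>x. f x *\<^sub>C (b :: 'a::complex_inner))"
proof -
  have "bounded_linear (\<lambda>a. a *\<^sub>C b)"
    by (rule bounded_linear_intro[where K = "norm b"])
       (simp_all add: scaleC_add_left scaleR_scaleC scaleC_scaleC scaleR_conv_of_real norm_scaleC)
  from bounded_linear.continuous_on[OF this assms] show ?thesis .
qed

lemma continuous_on_cinner_right:
  assumes "continuous_on S f"
  shows "continuous_on S (\<lambda>x. cinner w (f x :: 'a::complex_inner))"
proof -
  \<comment> \<open>The imaginary part of a complex number \<open>z\<close> is the real part of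
    \<open>- \<i> * z\<close>, so both coordinates are real inner products, whose continuity is
    known.\<close>
  have "cinner w y = Complex (inner w y) (inner ((- \<i>) *\<^sub>C w) y)" for y
    by (simp add: complex_eq_iff inner_eq_Re_cinner cinner_scaleC_left
        del: complex_vector.scale_minus_left)
  then show ?thesis
    using assms by (auto simp: Complex_eq intro!: continuous_intros)
qed

section \<open>Orthonormal bases and compactness of unit spheres\<close>

text \<open>Subtract from each new vector its projection onto the span built so far; a zero
  remainder adds nothing to the span, and a nonzero one is normalized and joined to the
  basis.\<close>

lemma gram_schmidt:
  fixes B :: "'a::complex_inner set"
  assumes "finite B"
  shows "\<exists>C. finite C \<and> complex_vector.span C = complex_vector.span B \<and>
    (\<forall>x\<in>C. \<forall>y\<in>C. cinner x y = (if x = y then 1 else 0))"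
  using assms
proof (induction B rule: finite_induct)
  case empty
  then show ?case by (intro exI[of _ "{}"]) simp
next
  case (insert b B)
  then obtain C where C: "finite C" "complex_vector.span C = complex_vector.span B"
    and ortho: "\<And>x y. x \<in> C \<Longrightarrow> y \<in> C \<Longrightarrow> cinner x y = (if x = y then 1 else 0)"
    by blast
  define p where "p = (\<Sum>x\<in>C. cinner b x *\<^sub>C x)"
  define c where "c = b - p"
  have p: "p \<in> complex_vector.span C" unfolding p_def
    by (intro complex_vector.span_sum complex_vector.span_scale complex_vector.span_base)
  have cC: "cinner c y = 0" if "y \<in> C" for y
  proof -
    have "cinner p y = (\<Sum>x\<in>C. if x = y then cinner b x else 0)"
      unfolding p_def cinner_sum_left
      by (intro sum.cong) (auto simp: cinner_scaleC_left ortho that)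
    then show ?thesis using that C(1) by (simp add: c_def cinner_diff_left)
  qed
  have span_bB: "complex_vector.span (insert b B) = complex_vector.span (insert c C)"
  proof -
    have "complex_vector.span (insert b B) = complex_vector.span (insert b C)"
      by (simp add: complex_vector.span_insert C(2))
    also have "\<dots> = complex_vector.span (insert c C)"
      unfolding c_def using p by (intro complex_vector.eq_span_insert_eq) simp
    finally show ?thesis .
  qed
  show ?case
  proof (cases "c = 0")
    case True
    with span_bB have "complex_vector.span (insert b B) = complex_vector.span C" by simp
    with C ortho show ?thesis by (intro exI[of _ C]) auto
  next
    case False
    define u where "u = complex_of_real (inverse (norm c)) *\<^sub>C c"
    have uC: "cinner u y = 0" "cinner y u = 0" if "y \<in> C" for y
    proof -
      show "cinner u y = 0" using cC[OF that] by (simp add: u_def cinner_scaleC_left)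
      then show "cinner y u = 0" by (subst cinner_commute) simp
    qed
    have uu: "cinner u u = 1"
      using False by (simp add: u_def cinner_self norm_scaleC norm_inverse)
    have "complex_vector.span (insert u C) = complex_vector.span (insert c C)"
    proof (rule antisym; rule complex_vector.span_minimal)
      show "insert u C \<subseteq> complex_vector.span (insert c C)"
        by (auto simp: u_def intro: complex_vector.span_base complex_vector.span_scale)
      have "c = complex_of_real (norm c) *\<^sub>C u"
        using False by (simp add: u_def scaleC_scaleC)
      then have "c \<in> complex_vector.span (insert u C)"
        by (metis complex_vector.span_base complex_vector.span_scale insertI1)
      then show "insert c C \<subseteq> complex_vector.span (insert u C)"
        by (auto intro: complex_vector.span_base)
    qed simp_all
    \<comment> \<open>Otherwise \<open>cinner u u\<close> would be both 0 and 1. So the case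
      \<open>x = y\<close> never pairs \<open>u\<close> with an old basis vector.\<close>
    moreover have "u \<notin> C" using uC(1)[of u] uu by auto
    ultimately show ?thesis using span_bB C(1) ortho uC uu
      by (intro exI[of _ "insert u C"]) auto
  qed
qed

text \<open>In an orthonormal basis a unit vector has coefficients of modulus at most 1. The sphere
  is therefore a closed part of the continuous image of a product of closed discs, which is compact
  by Tychonoff.\<close>

lemma compact_unit_sphere_span:
  fixes B :: "'a::complex_inner set"
  assumes "finite B"
  shows "compact (complex_vector.span B \<inter> sphere 0 1)"
proof -
  obtain C where C: "finite C" "complex_vector.span C = complex_vector.span B"
    and ortho: "\<And>x y. x \<in> C \<Longrightarrow> y \<in> C \<Longrightarrow> cinner x y = (if x = y then 1 else 0)"
    using gram_schmidt[OF assms] by blast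
  define F :: "('a \<Rightarrow> complex) \<Rightarrow> 'a" where "F = (\<lambda>a. \<Sum>c\<in>C. a c *\<^sub>C c)"
  \<comment> \<open>Coefficients are indexed by the whole type, so that the topology on functions is
    the product topology; values outside \<open>C\<close> do not affect \<open>F\<close>.\<close>
  define K :: "('a \<Rightarrow> complex) set" where "K = (\<Pi>\<^sub>E c\<in>UNIV. cball 0 1)"
  have K: "compact K" unfolding K_def
    using compactin_PiE[of "\<lambda>_. euclidean" UNIV "\<lambda>_::'a. cball (0::complex) 1"]
    by (simp add: euclidean_product_topology)
  have "continuous_on K F" unfolding F_def
    by (intro continuous_on_sum continuous_on_scaleC_left
        continuous_on_subset[OF continuous_on_product_coordinates subset_UNIV])
  moreover have "closed (sphere (0::'a) 1)"
    unfolding sphere_def by (intro closed_Collect_eq continuous_intros)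
  ultimately have "compact (F ` K \<inter> sphere 0 1)"
    by (intro compact_Int_closed compact_continuous_image K)
  moreover have "F ` K \<inter> sphere 0 1 = complex_vector.span B \<inter> sphere 0 1"
  proof (intro equalityI subsetI IntI)
    fix x assume "x \<in> F ` K \<inter> sphere 0 1"
    then show "x \<in> complex_vector.span B"
      unfolding F_def C(2)[symmetric]
      by (blast intro: complex_vector.span_sum complex_vector.span_scale complex_vector.span_base)
  next
    fix x assume x: "x \<in> complex_vector.span B \<inter> sphere 0 1"
    then obtain a where a: "x = (\<Sum>c\<in>C. a c *\<^sub>C c)"
      using C complex_vector.span_finite[of C] by auto
    have coeff: "cinner x c = a c" if "c \<in> C" for c
    proof -
      have "cinner x c = (\<Sum>y\<in>C. if y = c then a y else 0)"
        unfolding a cinner_sum_left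
        by (intro sum.cong) (auto simp: cinner_scaleC_left ortho that)
      then show ?thesis using that C(1) by simp
    qed
    have "complex_of_real 1 = cinner x x" using x by (simp add: cinner_self)
    also have "\<dots> = (\<Sum>c\<in>C. cnj (a c) * cinner x c)"
      by (subst (2) a) (simp add: cinner_sum_right cinner_scaleC_right)
    also have "\<dots> = of_real (\<Sum>c\<in>C. (cmod (a c))\<^sup>2)"
      unfolding of_real_sum complex_norm_square
      by (intro sum.cong) (simp_all add: coeff mult.commute)
    finally have "(\<Sum>c\<in>C. (cmod (a c))\<^sup>2) = 1" by (metis of_real_eq_iff)
    then have "(cmod (a c))\<^sup>2 \<le> 1" if "c \<in> C" for c
      using member_le_sum[of c C "\<lambda>c. (cmod (a c))\<^sup>2"] that C(1) by simp
    then have "cmod (a c) \<le> 1" if "c \<in> C" for c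
      using that by (simp add: abs_square_le_1)
    \<comment> \<open>The coefficients \<open>a\<close> are bounded only on \<open>C\<close>; the
      default 0 elsewhere stays in the disc.\<close>
    then have "(\<lambda>c. if c \<in> C then a c else 0) \<in> K" by (auto simp: K_def)
    moreover have "F (\<lambda>c. if c \<in> C then a c else 0) = x" by (simp add: F_def a)
    ultimately show "x \<in> F ` K" by blast
  qed auto
  ultimately show ?thesis by simp
qed

section \<open>Unit pure tensors and attainment of the maximum\<close>

context hilbert_tensor_product
begin

lemma norm_tensor:
  assumes "x \<in> (\<Pi>\<^sub>E e\<in>{1..d}. V e)"
  shows "norm (tensor x) = (\<Prod>e=1..d. norm (x e))"
proof -
  have "complex_of_real ((norm (tensor x))\<^sup>2) = of_real ((\<Prod>e=1..d. norm (x e))\<^sup>2)"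
    unfolding cinner_self[symmetric] cinner_tensor[OF assms assms]
    by (simp add: cinner_self prod_power_distrib)
  then have "(norm (tensor x))\<^sup>2 = (\<Prod>e=1..d. norm (x e))\<^sup>2" using of_real_eq_iff by blast
  then show ?thesis by (simp add: power2_eq_iff_nonneg prod_nonneg)
qed

lemma scaleC_V: "e \<in> {1..d} \<Longrightarrow> x \<in> V e \<Longrightarrow> a *\<^sub>C x \<in> V e"
  using finite_dim[of e] by (auto intro: complex_vector.span_scale)

lemma scaleR_pure_tensors:
  assumes "u \<in> pure_tensors d V tensor"
  shows "c *\<^sub>R u \<in> pure_tensors d V tensor"
proof -
  from assms obtain x where x: "x \<in> (\<Pi>\<^sub>E e\<in>{1..d}. V e)" "u = tensor x"
    by (auto simp: pure_tensors_def)
  \<comment> \<open>The scalar is absorbed into the first factor, which exists because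
    \<open>1 \<le> d\<close>.\<close>
  have 1: "1 \<in> {1..d}" using d_pos by simp
  with x have x1: "x 1 \<in> V 1" by auto
  have "c *\<^sub>R u = tensor (x(1 := complex_of_real c *\<^sub>C x 1))"
    using tensor_scaleC[OF x(1) 1 x1, of "complex_of_real c"] by (simp add: x scaleR_scaleC)
  moreover have "x(1 := complex_of_real c *\<^sub>C x 1) \<in> (\<Pi>\<^sub>E e\<in>{1..d}. V e)"
    using x(1) 1 scaleC_V[OF 1 x1] by (auto simp: PiE_iff extensional_def)
  ultimately show ?thesis by (auto simp: pure_tensors_def)
qed

text \<open>The factor norms multiply to 1, so dividing each factor by its norm changes no product
  of inner products. Comparing inner products rather than the tensors themselves lets the product
  formula suffice. The gain is a bounded set of representatives for the unit pure tensors.\<close>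

lemma unit_pure_tensor_normalize:
  assumes "u \<in> pure_tensors d V tensor" "norm u = 1"
  shows "\<exists>y\<in>(\<Pi>\<^sub>E e\<in>{1..d}. V e \<inter> sphere 0 1).
    \<forall>v\<in>pure_tensors d V tensor. cinner v u = cinner v (tensor y)"
proof -
  from assms obtain x where x: "x \<in> (\<Pi>\<^sub>E e\<in>{1..d}. V e)" "u = tensor x"
    by (auto simp: pure_tensors_def)
  then have n1: "(\<Prod>e=1..d. norm (x e)) = 1" using norm_tensor assms by simp
  then have pos: "norm (x e) \<noteq> 0" if "e \<in> {1..d}" for e
    using that by (metis prod_zero_iff finite_atLeastAtMost zero_neq_one)
  define y where "y = (\<lambda>e\<in>{1..d}. complex_of_real (inverse (norm (x e))) *\<^sub>C x e)"
  have yV: "y e \<in> V e \<inter> sphere 0 1" if e: "e \<in> {1..d}" for e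
    using scaleC_V[OF e, of "x e"] x(1) e pos[OF e] by (auto simp: y_def norm_scaleC PiE_iff norm_inverse)
  then have y: "y \<in> (\<Pi>\<^sub>E e\<in>{1..d}. V e \<inter> sphere 0 1)"
    by (auto simp: y_def)
  then have y': "y \<in> (\<Pi>\<^sub>E e\<in>{1..d}. V e)" by auto
  have "cinner (tensor w) u = cinner (tensor w) (tensor y)" if w: "w \<in> (\<Pi>\<^sub>E e\<in>{1..d}. V e)" for w
  proof -
    have "cinner (tensor w) (tensor y)
        = (\<Prod>e=1..d. of_real (inverse (norm (x e))) * cinner (w e) (x e))"
      unfolding cinner_tensor[OF w y']
      by (intro prod.cong) (auto simp: y_def cinner_scaleC_right)
    also have "\<dots> = inverse (of_real (\<Prod>e=1..d. norm (x e))) * (\<Prod>e=1..d. cinner (w e) (x e))"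
      by (simp add: prod.distrib flip: prod_inversef)
    finally show ?thesis unfolding n1 by (simp add: x cinner_tensor[OF w x(1)])
  qed
  with y show ?thesis by (auto simp: pure_tensors_def intro!: bexI[of _ y])
qed

text \<open>Since each \<open>S i\<close> is pure, the sum is an explicit continuous function of the
  factors of the unit tensor. These range over a compact product of unit spheres, which
  \<open>u0\<close> shows to be nonempty.\<close>

lemma sum_cinner_attains_max:
  assumes S: "\<And>i. i \<in> A \<Longrightarrow> S i \<in> pure_tensors d V tensor"
    and u0: "u0 \<in> pure_tensors d V tensor" "norm u0 = 1"
  obtains u where "u \<in> pure_tensors d V tensor" "norm u = 1"
    "\<And>u'. u' \<in> pure_tensors d V tensor \<Longrightarrow> norm u' = 1 \<Longrightarrow>
      (\<Sum>i\<in>A. cmod (cinner (S i) u')) \<le> (\<Sum>i\<in>A. cmod (cinner (S i) u))"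
proof -
  define K where "K = (\<Pi>\<^sub>E e\<in>{1..d}. V e \<inter> sphere 0 1)"
  have "compact (V e \<inter> sphere 0 1)" if "e \<in> {1..d}" for e
    using finite_dim[OF that] compact_unit_sphere_span by auto
  \<comment> \<open>Extensional functions on \<open>{1..d}\<close> form a full product over all of
    \<open>nat\<close> once the other coordinates are confined to the point
    \<open>undefined\<close>, so Tychonoff applies.\<close>
  then have "compact (\<Pi>\<^sub>E e\<in>UNIV. if e \<in> {1..d} then V e \<inter> sphere 0 1 else {undefined})"
    using compactin_PiE[of "\<lambda>_. euclidean" UNIV
        "\<lambda>e. if e \<in> {1..d} then V e \<inter> sphere 0 1 else {undefined}"]
    by (simp add: euclidean_product_topology)
  moreover have "K = (\<Pi>\<^sub>E e\<in>UNIV. if e \<in> {1..d} then V e \<inter> sphere 0 1 else {undefined})"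
    by (force simp: K_def PiE_iff extensional_def split: if_splits)
  ultimately have K: "compact K" by simp
  have KV: "x \<in> (\<Pi>\<^sub>E e\<in>{1..d}. V e)" if "x \<in> K" for x
    using that by (auto simp: K_def PiE_iff)
  have "\<exists>w\<in>(\<Pi>\<^sub>E e\<in>{1..d}. V e). S i = tensor w" if "i \<in> A" for i
    using S[OF that] by (auto simp: pure_tensors_def)
  then obtain w where w: "\<And>i. i \<in> A \<Longrightarrow> w i \<in> (\<Pi>\<^sub>E e\<in>{1..d}. V e) \<and> S i = tensor (w i)"
    by metis
  have prod: "cinner (S i) (tensor x) = (\<Prod>e=1..d. cinner (w i e) (x e))"
    if "i \<in> A" "x \<in> K" for i x
    using w[OF that(1)] cinner_tensor KV[OF that(2)] by simp
  have "continuous_on K (\<lambda>x. \<Sum>i\<in>A. cmod (\<Prod>e=1..d. cinner (w i e) (x e)))"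
    by (intro continuous_on_sum continuous_on_norm continuous_on_prod
        continuous_on_cinner_right
        continuous_on_subset[OF continuous_on_product_coordinates subset_UNIV])
  then have cont: "continuous_on K (\<lambda>x. \<Sum>i\<in>A. cmod (cinner (S i) (tensor x)))"
    by (rule continuous_on_eq) (simp add: prod)
  have ne: "K \<noteq> {}"
    using unit_pure_tensor_normalize[OF u0] by (auto simp: K_def)
  obtain x where x: "x \<in> K" and max: "\<And>y. y \<in> K \<Longrightarrow>
      (\<Sum>i\<in>A. cmod (cinner (S i) (tensor y))) \<le> (\<Sum>i\<in>A. cmod (cinner (S i) (tensor x)))"
    using continuous_attains_sup[OF K ne cont] by blast
  show thesis
  proof
    show "tensor x \<in> pure_tensors d V tensor"
      using KV[OF x] by (auto simp: pure_tensors_def)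
    show "norm (tensor x) = 1"
      unfolding norm_tensor[OF KV[OF x]] using x by (intro prod.neutral) (auto simp: K_def PiE_iff)
    fix u' assume "u' \<in> pure_tensors d V tensor" "norm u' = 1"
    from unit_pure_tensor_normalize[OF this] obtain y where y: "y \<in> K"
      "\<And>v. v \<in> pure_tensors d V tensor \<Longrightarrow> cinner v u' = cinner v (tensor y)"
      unfolding K_def by blast
    have "(\<Sum>i\<in>A. cmod (cinner (S i) u')) = (\<Sum>i\<in>A. cmod (cinner (S i) (tensor y)))"
      using y(2) S by simp
    with max[OF y(1)] show "(\<Sum>i\<in>A. cmod (cinner (S i) u')) \<le> (\<Sum>i\<in>A. cmod (cinner (S i) (tensor x)))"
      by simp
  qed
qed

text \<open>The exponent \<open>2 / 2\<close> is 1, so \<open>tuple_norm\<close> is the greatest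
  such sum. \<open>GREATEST\<close> yields an upper bound only once a maximizer \<open>m\<close> is
  known to exist.\<close>

lemma two_orthogonal_sum_le:
  assumes S: "\<And>i. i \<in> {1..r} \<Longrightarrow> S i \<in> pure_tensors d V tensor"
    and ortho: "t_orthogonal (pure_tensors d V tensor) 2 r S"
    and u: "u \<in> pure_tensors d V tensor" "norm u = 1"
  shows "(\<Sum>i=1..r. cmod (cinner (S i) u)) \<le> 1"
proof -
  let ?P = "pure_tensors d V tensor"
  obtain m where m: "m \<in> ?P" "norm m = 1"
    and max: "\<And>u'. u' \<in> ?P \<Longrightarrow> norm u' = 1 \<Longrightarrow>
      (\<Sum>i=1..r. cmod (cinner (S i) u')) \<le> (\<Sum>i=1..r. cmod (cinner (S i) m))"
    using sum_cinner_attains_max[of "{1..r}" S u] S u by blast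
  have "tuple_norm ?P (2 / 2) r S = (\<Sum>i=1..r. cmod (cinner (S i) m))"
    unfolding tuple_norm_def
    by (rule Greatest_equality) (use m max in \<open>auto simp: sum_nonneg\<close>)
  with ortho have "(\<Sum>i=1..r. cmod (cinner (S i) m)) = 1"
    by (simp add: t_orthogonal_def)
  with max[OF u] show ?thesis by simp
qed

end

section \<open>The three norms of a diagonal decomposition\<close>

text \<open>Abstract form of the situation: pure tensors become a set closed under real scaling, and
  2-orthogonality becomes unit norms together with the inequality \<open>sum_le\<close>.\<close>

locale diagonal_decomposition =
  fixes P :: "'b::complex_inner set" and r :: nat and v :: "nat \<Rightarrow> 'b"
    and \<sigma> :: "nat \<Rightarrow> real" and T :: 'b
  assumes scaleR_P: "u \<in> P \<Longrightarrow> c *\<^sub>R u \<in> P"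
    and v_P: "i \<in> {1..r} \<Longrightarrow> v i \<in> P"
    and norm_v: "i \<in> {1..r} \<Longrightarrow> norm (v i) = 1"
    and sum_le: "u \<in> P \<Longrightarrow> norm u = 1 \<Longrightarrow> (\<Sum>i=1..r. cmod (cinner (v i) u)) \<le> 1"
    and r_pos: "1 \<le> r"
    and antimono: "antimono_on {1..r} \<sigma>"
    and \<sigma>_r_pos: "0 < \<sigma> r"
    and T_eq: "T = (\<Sum>i=1..r. \<sigma> i *\<^sub>R v i)"
begin

lemma \<sigma>_pos: "i \<in> {1..r} \<Longrightarrow> 0 < \<sigma> i"
  using monotone_onD[OF antimono, of i r] \<sigma>_r_pos r_pos by fastforce

lemma \<sigma>_le_first: "i \<in> {1..r} \<Longrightarrow> \<sigma> i \<le> \<sigma> 1"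
  using monotone_onD[OF antimono, of 1 i] r_pos by auto

lemma orthonormal:
  assumes "i \<in> {1..r}" "j \<in> {1..r}"
  shows "cinner (v i) (v j) = (if i = j then 1 else 0)"
proof -
  have jj: "cinner (v j) (v j) = 1" by (simp add: cinner_self norm_v[OF assms(2)] del: One_nat_def)
  \<comment> \<open>The term at \<open>j\<close> alone already uses up the bound 1 of
    \<open>sum_le\<close> at \<open>u = v j\<close>, leaving nothing for the others.\<close>
  have "(\<Sum>k\<in>{1..r} - {j}. cmod (cinner (v k) (v j))) \<le> 0"
    using sum_le[OF v_P[OF assms(2)] norm_v[OF assms(2)]] jj
      sum.remove[OF _ assms(2), of "\<lambda>k. cmod (cinner (v k) (v j))"] by simp
  then have "(\<Sum>k\<in>{1..r} - {j}. cmod (cinner (v k) (v j))) = 0"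
    by (intro antisym sum_nonneg) auto
  then have "\<forall>k\<in>{1..r} - {j}. cmod (cinner (v k) (v j)) = 0"
    by (subst (asm) sum_nonneg_eq_0_iff) auto
  with jj assms show ?thesis by auto
qed

lemma cinner_T_v: "i \<in> {1..r} \<Longrightarrow> cinner T (v i) = of_real (\<sigma> i)"
proof -
  assume i: "i \<in> {1..r}"
  have "cinner T (v i) = (\<Sum>k=1..r. if k = i then of_real (\<sigma> k) else 0)"
    unfolding T_eq cinner_sum_left
    by (intro sum.cong) (use i in \<open>simp_all add: cinner_scaleR_left orthonormal\<close>)
  then show ?thesis using i by simp
qed

lemma norm_T: "norm T = sqrt (\<Sum>i=1..r. (\<sigma> i)\<^sup>2)"
proof -
  have "complex_of_real ((norm T)\<^sup>2) = cinner T T" by (simp add: cinner_self)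
  also have "\<dots> = (\<Sum>i=1..r. of_real (\<sigma> i) * cinner T (v i))"
    by (subst (2) T_eq) (simp add: cinner_sum_right cinner_scaleR_right)
  also have "\<dots> = of_real (\<Sum>i=1..r. (\<sigma> i)\<^sup>2)"
    by (simp add: cinner_T_v power2_eq_square)
  finally have "(norm T)\<^sup>2 = (\<Sum>i=1..r. (\<sigma> i)\<^sup>2)" using of_real_eq_iff by blast
  then show ?thesis by (metis norm_ge_zero real_sqrt_unique)
qed

text \<open>The value is attained at \<open>v 1\<close>; the upper bound combines
  \<open>\<sigma>_le_first\<close> with \<open>sum_le\<close>.\<close>

lemma spectral_norm_T: "spectral_norm P T = \<sigma> 1"
  unfolding spectral_norm_def
proof (rule Greatest_equality)
  have 1: "1 \<in> {1..r}" using r_pos by simp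
  show "\<exists>u\<in>P. norm u = 1 \<and> \<sigma> 1 = cmod (cinner T u)"
    using v_P[OF 1] norm_v[OF 1] cinner_T_v[OF 1] \<sigma>_pos[OF 1] by (intro bexI[of _ "v 1"]) auto
next
  fix s assume "\<exists>u\<in>P. norm u = 1 \<and> s = cmod (cinner T u)"
  then obtain u where u: "u \<in> P" "norm u = 1" and s: "s = cmod (cinner T u)" by blast
  have "s \<le> (\<Sum>i=1..r. cmod (of_real (\<sigma> i) * cinner (v i) u))"
    unfolding s T_eq cinner_sum_left cinner_scaleR_left by (rule norm_sum)
  also have "\<dots> = (\<Sum>i=1..r. \<sigma> i * cmod (cinner (v i) u))"
    using \<sigma>_pos by (intro sum.cong) (auto simp: norm_mult less_imp_le)
  also have "\<dots> \<le> (\<Sum>i=1..r. \<sigma> 1 * cmod (cinner (v i) u))"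
    using \<sigma>_le_first by (intro sum_mono mult_right_mono) auto
  also have "\<dots> = \<sigma> 1 * (\<Sum>i=1..r. cmod (cinner (v i) u))" by (simp add: sum_distrib_left)
  also have "\<dots> \<le> \<sigma> 1 * 1"
    using sum_le[OF u] \<sigma>_pos[of 1] r_pos by (intro mult_left_mono) auto
  finally show "s \<le> \<sigma> 1" by simp
qed

text \<open>Homogeneous form of \<open>sum_le\<close>, obtained by scaling \<open>u\<close> to unit
  length inside \<open>P\<close>. It makes the sum of the \<open>v i\<close> a dual certificate for
  the nuclear norm.\<close>

lemma cmod_cinner_sum_v_le:
  assumes "u \<in> P"
  shows "cmod (cinner u (\<Sum>i=1..r. v i)) \<le> norm u"
proof (cases "u = 0")
  case False
  define n where "n = inverse (norm u) *\<^sub>R u"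
  have n: "n \<in> P" "norm n = 1" using False assms scaleR_P by (auto simp: n_def)
  have "cmod (cinner n (\<Sum>i=1..r. v i)) \<le> (\<Sum>i=1..r. cmod (cinner n (v i)))"
    unfolding cinner_sum_right by (rule norm_sum)
  also have "\<dots> = (\<Sum>i=1..r. cmod (cinner (v i) n))"
    by (intro sum.cong refl) (metis cinner_commute complex_mod_cnj)
  also have "\<dots> \<le> 1" by (rule sum_le[OF n])
  finally have "cmod (cinner n (\<Sum>i=1..r. v i)) \<le> 1" .
  moreover have "cmod (cinner n (\<Sum>i=1..r. v i)) = cmod (cinner u (\<Sum>i=1..r. v i)) / norm u"
    unfolding n_def cinner_scaleR_left norm_mult norm_of_real by (simp add: divide_inverse mult.commute)
  ultimately show ?thesis using False by (metis divide_le_eq_1_pos zero_less_norm_iff)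
qed simp

text \<open>The terms \<open>\<sigma> i *\<^sub>R v i\<close> are themselves a decomposition into
  elements of \<open>P\<close>, of the claimed cost; the dual certificate rules out a cheaper
  one.\<close>

lemma nuclear_norm_T: "nuclear_norm P T = (\<Sum>i=1..r. \<sigma> i)"
  unfolding nuclear_norm_def
proof (rule Least_equality)
  show "\<exists>(m::nat) w. (\<forall>i\<in>{1..m}. w i \<in> P) \<and> T = (\<Sum>i=1..m. w i) \<and>
      (\<Sum>i=1..r. \<sigma> i) = (\<Sum>i=1..m. norm (w i))"
    using v_P scaleR_P T_eq norm_v \<sigma>_pos
    by (intro exI[of _ r] exI[of _ "\<lambda>i. \<sigma> i *\<^sub>R v i"]) (auto simp: less_imp_le intro!: sum.cong)
next
  fix s assume "\<exists>(m::nat) w. (\<forall>i\<in>{1..m}. w i \<in> P) \<and> T = (\<Sum>i=1..m. w i) \<and>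
      s = (\<Sum>i=1..m. norm (w i))"
  then obtain m :: nat and w where w: "\<And>i. i \<in> {1..m} \<Longrightarrow> w i \<in> P"
    and T: "T = (\<Sum>i=1..m. w i)" and s: "s = (\<Sum>i=1..m. norm (w i))" by blast
  \<comment> \<open>The same pairing is evaluated twice: by orthonormality here, then through the
    competing decomposition \<open>w\<close>.\<close>
  have "complex_of_real (\<Sum>i=1..r. \<sigma> i) = cinner T (\<Sum>i=1..r. v i)"
    by (simp add: cinner_sum_right cinner_T_v)
  also have "\<dots> = (\<Sum>j=1..m. cinner (w j) (\<Sum>i=1..r. v i))"
    unfolding T by (rule cinner_sum_left)
  finally have "\<bar>\<Sum>i=1..r. \<sigma> i\<bar> = cmod (\<Sum>j=1..m. cinner (w j) (\<Sum>i=1..r. v i))"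
    by (metis norm_of_real)
  also have "\<dots> \<le> s" unfolding s
    by (intro order.trans[OF norm_sum] sum_mono cmod_cinner_sum_v_le w)
  finally show "(\<Sum>i=1..r. \<sigma> i) \<le> s" by simp
qed

end

theorem theorem1p6:
  fixes d r :: nat
    and V :: "nat \<Rightarrow> 'a::complex_inner set"
    and W :: "'b::complex_inner set"
    and tensor :: "(nat \<Rightarrow> 'a) \<Rightarrow> 'b"
    and T :: 'b
    and \<sigma> :: "nat \<Rightarrow> real"
    and v :: "nat \<Rightarrow> 'b"
  assumes "hilbert_tensor_product d V W tensor"
    and "T \<in> W"
    and "diagonal_svd (pure_tensors d V tensor) T r \<sigma> v"
  shows "nuclear_norm (pure_tensors d V tensor) T = (\<Sum>i=1..r. \<sigma> i) \<and>
         spectral_norm (pure_tensors d V tensor) T = \<sigma> 1 \<and>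
         norm T = sqrt (\<Sum>i=1..r. (\<sigma> i)\<^sup>2)"
proof -
  interpret hilbert_tensor_product d V W tensor by fact
  \<comment> \<open>The only assumptions not read off from \<open>diagonal_svd\<close> are
    \<open>sum_le\<close> and closure under scaling, supplied by the two cited lemmas.\<close>
  interpret diagonal_decomposition "pure_tensors d V tensor" r v \<sigma> T
    using assms(3) two_orthogonal_sum_le[of r v] scaleR_pure_tensors
    by unfold_locales (auto simp: diagonal_svd_def t_orthogonal_def)
  show ?thesis using nuclear_norm_T spectral_norm_T norm_T by blast
qed

end
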